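(* Let $V$ be the value function of the reflected optimal stopping problem in the context, $H:=V-G\ge0$, $\mathcal D:=\{x\in\mathbb R^2_+:H(x)=0\}$, and $\mathcal D(x_1):=\{x_2\ge0:(x_1,x_2)\in\mathcal D\}$ for $x_1\ge0$. Assume that $V$ is continuous, that for every $x_1\ge0$ the map $x_2\mapsto H(x_1,x_2)$ is nonincreasing on $[0,\infty)$, and that $\mathcal D(x_1)\neq\varnothing$ for every $x_1\ge0$. Define $b(x_1):=\inf\mathcal D(x_1)$ for $x_1\ge0$. Then $b$ is well defined with values in $[0,\infty)$ and $$\mathcal D=\{(x_1,x_2)\in\mathbb R^2_+:x_2\ge b(x_1)\}.$$ If, in addition, for every $x_2\ge0$ the map $x_1\mapsto H(x_1,x_2)$ is monotone on $[0,\infty)$ with a direction independent of $x_2$, then $b$ is monotone: if all maps $x_1\mapsto H(x_1,x_2)$ are nonincreasing then $b$ is nonincreasing, and if all are nondecreasing then $b$ is nondecreasing.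
   Context: Setting. $\mathbb R^2_+=[0,\infty)^2$, discount rate $r>0$, $\alpha>0$, $W$ a two-dimensional Brownian motion on a filtered probability space satisfying the usual conditions. For $x\in\mathbb R^2_+$, $X=X^x$ solves the normally reflected SDE $X_t=x+\int_0^t\mu(X_s)ds+\int_0^t\sigma(X_s)dW_s+L_t$ in $\mathbb R^2_+$, where $L=(L^1,L^2)$, each $L^i$ is continuous, nondecreasing, $L^i_0=0$, and $\int_0^\infty\mathbf 1_{\{X^i_t>0\}}dL^i_t=0$. Put $a=\sigma\sigma^\top$. Standing assumptions: (A1) $\mu,\sigma$ are locally Lipschitz with at most linear growth. (A2) For every compact $K\subset\mathbb R^2_+$ there is $\lambda_K>0$ with $\xi^\top a(x)\xi\ge\lambda_K|\xi|^2$ for $x\in K$, $\xi\in\mathbb R^2$. (A3) The reflected SDE has a unique strong solution for each $x$ and the family is strong Markov. (A4) For every $T>0$, every compact $K\subset\mathbb R^2_+$ and some $q\ge1$, $\lim_{y\to x}\mathbb E[\sup_{t\le T}|X^y_t-X^x_t|^q]=0$ for $x\in K$. (A5) $G(x_1,x_2)=x_1\vee\alpha x_2$, and $c:\mathbb R^2_+\to[0,\infty)$ is continuous. (A6) $V$ below satisfies $0\le V(x)\le C_V(1+|x|^p)$ for some $C_V>0,p\ge1$, and the payoff terms are integrable for all stopping times considered. Value function: $V(x)=\sup_\tau\mathbb E_x[e^{-r\tau}G(X_\tau)-\int_0^\tau e^{-rs}c(X_s)ds]$ over all $[0,\infty]$-valued stopping times, with $e^{-r\tau}G(X_\tau):=0$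 on $\{\tau=\infty\}$. Taking $\tau=0$ gives $V\ge G$. *)

theory Defs
  imports "HOL-Probability.Probability"
begin

definition quadrant :: "(real^2) set" where
  "quadrant = {x. 0 \<le> x $ 1 \<and> 0 \<le> x $ 2}"


section \<open>Filtered probability spaces and Brownian motion\<close>

text \<open>
  Time is \<open>[0, \<infinity>]\<close>, i.e. type \<^typ>\<open>ennreal\<close>, for filtrations and stopping times, so that the
  library notion \<^const>\<open>stopping_time\<close> covers stopping times that may be infinite; the
  \<open>\<sigma>\<close>-algebra \<open>F \<infinity>\<close> is any one between the union of the \<open>F t\<close> and the events of \<open>M\<close>.
  Processes are indexed by \<^typ>\<open>real\<close>, and only times \<open>t \<ge> 0\<close> matter.
\<close>

definition usual_conditions :: "'w measure \<Rightarrow> (ennreal \<Rightarrow> 'w measure) \<Rightarrow> bool" where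
  "usual_conditions M F \<longleftrightarrow>
     prob_space M \<and> filtration (space M) F \<and> (\<forall>t. sets (F t) \<subseteq> sets M) \<and>
     (\<forall>A\<in>null_sets M. \<forall>N\<subseteq>A. N \<in> sets (F 0)) \<and>
     (\<forall>t<\<infinity>. sets (F t) = (\<Inter>s\<in>{t<..}. sets (F s)))"

definition adapted ::
  "(ennreal \<Rightarrow> 'w measure) \<Rightarrow> (real \<Rightarrow> 'w \<Rightarrow> 'b::topological_space) \<Rightarrow> bool" where
  "adapted F Y \<longleftrightarrow> (\<forall>t\<ge>0. Y t \<in> borel_measurable (F (ennreal t)))"

definition brownian_motion ::
  "'w measure \<Rightarrow> (ennreal \<Rightarrow> 'w measure) \<Rightarrow> (real \<Rightarrow> 'w \<Rightarrow> real^'n) \<Rightarrow> bool" where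
  "brownian_motion M F W \<longleftrightarrow>
     adapted F W \<and>
     (AE \<omega> in M. W 0 \<omega> = 0) \<and>
     (AE \<omega> in M. continuous_on {0..} (\<lambda>t. W t \<omega>)) \<and>
     (\<forall>s t. 0 \<le> s \<and> s < t \<longrightarrow>
        prob_space.indep_set M (sets (F (ennreal s)))
          (sets (vimage_algebra (space M) (\<lambda>\<omega>. W t \<omega> - W s \<omega>) borel)) \<and>
        distributed M lborel (\<lambda>\<omega>. W t \<omega> - W s \<omega>)
          (\<lambda>z. ennreal (\<Prod>i\<in>UNIV. normal_density 0 (sqrt (t - s)) (z $ i))))"

definition augmented_filtration ::
  "'w measure \<Rightarrow> (real \<Rightarrow> 'w \<Rightarrow> 'b::topological_space) \<Rightarrow> ennreal \<Rightarrow> 'w measure" where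
  "augmented_filtration M W t =
     sigma (space M)
       ({W s -` B \<inter> space M | s B. 0 \<le> s \<and> ennreal s \<le> t \<and> B \<in> sets borel} \<union>
        {N. \<exists>A\<in>null_sets M. N \<subseteq> A})"


section \<open>The Ito integral\<close>

text \<open>
  The integral of \<open>\<Sum>k<N. 1_(u k, u (k+1)] \<xi> k\<close>, with \<open>\<xi> k\<close> bounded and
  \<open>F (u k)\<close>-measurable, is elementary; a continuous adapted process is the integral of \<open>H\<close> if
  it is the limit, uniformly on compacts in probability, of elementary integrals of integrands
  converging to \<open>H\<close> in \<open>L\<^sup>2([0,T])\<close> in probability for all \<open>T\<close>. The norm on matrices is the
  Frobenius norm.
\<close>

definition elementary_integrand ::
  "(ennreal \<Rightarrow> 'w measure) \<Rightarrow> nat \<Rightarrow> (nat \<Rightarrow> real) \<Rightarrow> (nat \<Rightarrow> 'w \<Rightarrow> real^'n^'m) \<Rightarrow> bool" where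
  "elementary_integrand F N u \<xi> \<longleftrightarrow>
     0 \<le> u 0 \<and> (\<forall>k<N. u k \<le> u (Suc k)) \<and>
     (\<forall>k<N. \<xi> k \<in> borel_measurable (F (ennreal (u k))) \<and>
            bounded (\<xi> k ` space (F (ennreal (u k)))))"

definition elementary_process ::
  "nat \<Rightarrow> (nat \<Rightarrow> real) \<Rightarrow> (nat \<Rightarrow> 'w \<Rightarrow> real^'n^'m) \<Rightarrow> real \<Rightarrow> 'w \<Rightarrow> real^'n^'m" where
  "elementary_process N u \<xi> s \<omega> = (\<Sum>k<N. indicator {u k<..u (Suc k)} s *\<^sub>R \<xi> k \<omega>)"

definition elementary_integral ::
  "(real \<Rightarrow> 'w \<Rightarrow> real^'n) \<Rightarrow> nat \<Rightarrow> (nat \<Rightarrow> real) \<Rightarrow> (nat \<Rightarrow> 'w \<Rightarrow> real^'n^'m) \<Rightarrow>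
   real \<Rightarrow> 'w \<Rightarrow> real^'m" where
  "elementary_integral W N u \<xi> t \<omega> =
     (\<Sum>k<N. \<xi> k \<omega> *v (W (min (u (Suc k)) t) \<omega> - W (min (u k) t) \<omega>))"

definition tendsto_zero_in_prob :: "'w measure \<Rightarrow> (nat \<Rightarrow> 'w \<Rightarrow> ennreal) \<Rightarrow> bool" where
  "tendsto_zero_in_prob M Z \<longleftrightarrow>
     (\<forall>n. Z n \<in> borel_measurable M) \<and>
     (\<forall>\<epsilon>>0. (\<lambda>n. measure M {\<omega>\<in>space M. ennreal \<epsilon> < Z n \<omega>}) \<longlonglongrightarrow> 0)"

definition is_ito_integral ::
  "'w measure \<Rightarrow> (ennreal \<Rightarrow> 'w measure) \<Rightarrow> (real \<Rightarrow> 'w \<Rightarrow> real^'n) \<Rightarrow>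
   (real \<Rightarrow> 'w \<Rightarrow> real^'n^'m) \<Rightarrow> (real \<Rightarrow> 'w \<Rightarrow> real^'m) \<Rightarrow> bool" where
  "is_ito_integral M F W H I \<longleftrightarrow>
     adapted F H \<and> adapted F I \<and> (AE \<omega> in M. continuous_on {0..} (\<lambda>t. I t \<omega>)) \<and>
     (\<exists>N u \<xi>. (\<forall>n. elementary_integrand F (N n) (u n) (\<xi> n)) \<and>
        (\<forall>T>0.
           tendsto_zero_in_prob M (\<lambda>n \<omega>.
             \<integral>\<^sup>+s\<in>{0..T}. ennreal ((norm (elementary_process (N n) (u n) (\<xi> n) s \<omega> - H s \<omega>))\<^sup>2) \<partial>lborel) \<and>
           tendsto_zero_in_prob M (\<lambda>n \<omega>.
             SUP t\<in>{0..T}. ennreal (norm (elementary_integral W (N n) (u n) (\<xi> n) t \<omega> - I t \<omega>)))))"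


section \<open>The normally reflected SDE\<close>

text \<open>
  The measure \<open>dL\<^sup>i\<close> on \<open>[0, \<infinity>)\<close> is the Stieltjes measure of \<open>L\<^sup>i\<close> extended by its value at
  \<open>0\<close> to negative times.
\<close>

definition reflected_solution ::
  "'w measure \<Rightarrow> (ennreal \<Rightarrow> 'w measure) \<Rightarrow> (real \<Rightarrow> 'w \<Rightarrow> real^2) \<Rightarrow>
   (real^2 \<Rightarrow> real^2) \<Rightarrow> (real^2 \<Rightarrow> real^2^2) \<Rightarrow> real^2 \<Rightarrow>
   (real \<Rightarrow> 'w \<Rightarrow> real^2) \<Rightarrow> (real \<Rightarrow> 'w \<Rightarrow> real^2) \<Rightarrow> bool" where
  "reflected_solution M F W \<mu> \<sigma> x X L \<longleftrightarrow>
     adapted F X \<and> adapted F L \<and>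
     (AE \<omega> in M. continuous_on {0..} (\<lambda>t. X t \<omega>) \<and> (\<forall>t\<ge>0. X t \<omega> \<in> quadrant)) \<and>
     (AE \<omega> in M. \<forall>i.
        continuous_on {0..} (\<lambda>t. L t \<omega> $ i) \<and> mono_on {0..} (\<lambda>t. L t \<omega> $ i) \<and> L 0 \<omega> $ i = 0 \<and>
        (\<integral>\<^sup>+t. indicator {t. 0 \<le> t \<and> 0 < X t \<omega> $ i} t
           \<partial>interval_measure (\<lambda>t. L (max 0 t) \<omega> $ i)) = 0) \<and>
     (\<exists>I. is_ito_integral M F W (\<lambda>s \<omega>. \<sigma> (X s \<omega>)) I \<and>
        (AE \<omega> in M. \<forall>t\<ge>0.
           X t \<omega> = x + set_lebesgue_integral lborel {0..t} (\<lambda>s. \<mu> (X s \<omega>)) + I t \<omega> + L t \<omega>))"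

definition strong_solution ::
  "'w measure \<Rightarrow> (ennreal \<Rightarrow> 'w measure) \<Rightarrow> (real \<Rightarrow> 'w \<Rightarrow> real^2) \<Rightarrow>
   (real^2 \<Rightarrow> real^2) \<Rightarrow> (real^2 \<Rightarrow> real^2^2) \<Rightarrow> real^2 \<Rightarrow>
   (real \<Rightarrow> 'w \<Rightarrow> real^2) \<Rightarrow> (real \<Rightarrow> 'w \<Rightarrow> real^2) \<Rightarrow> bool" where
  "strong_solution M F W \<mu> \<sigma> x X L \<longleftrightarrow>
     reflected_solution M F W \<mu> \<sigma> x X L \<and>
     adapted (augmented_filtration M W) X \<and> adapted (augmented_filtration M W) L"

definition unique_strong_solution ::
  "'w measure \<Rightarrow> (ennreal \<Rightarrow> 'w measure) \<Rightarrow> (real \<Rightarrow> 'w \<Rightarrow> real^2) \<Rightarrow>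
   (real^2 \<Rightarrow> real^2) \<Rightarrow> (real^2 \<Rightarrow> real^2^2) \<Rightarrow> real^2 \<Rightarrow>
   (real \<Rightarrow> 'w \<Rightarrow> real^2) \<Rightarrow> (real \<Rightarrow> 'w \<Rightarrow> real^2) \<Rightarrow> bool" where
  "unique_strong_solution M F W \<mu> \<sigma> x X L \<longleftrightarrow>
     strong_solution M F W \<mu> \<sigma> x X L \<and>
     (\<forall>X' L'. reflected_solution M F W \<mu> \<sigma> x X' L' \<longrightarrow>
        (AE \<omega> in M. \<forall>t\<ge>0. X' t \<omega> = X t \<omega> \<and> L' t \<omega> = L t \<omega>))"

definition strong_markov ::
  "'w measure \<Rightarrow> (ennreal \<Rightarrow> 'w measure) \<Rightarrow> (real^2 \<Rightarrow> real \<Rightarrow> 'w \<Rightarrow> real^2) \<Rightarrow> bool" where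
  "strong_markov M F X \<longleftrightarrow>
     (\<forall>f :: real^2 \<Rightarrow> real. f \<in> borel_measurable borel \<and> bounded (range f) \<longrightarrow>
        (\<forall>t\<ge>0.
           (\<lambda>y. \<integral>\<omega>. f (X y t \<omega>) \<partial>M) \<in> borel_measurable (restrict_space borel quadrant) \<and>
           (\<forall>x\<in>quadrant. \<forall>\<tau>. stopping_time F \<tau> \<longrightarrow>
              (AE \<omega> in M. \<tau> \<omega> < \<infinity> \<longrightarrow>
                 real_cond_exp M (filtration.pre_sigma (space M) F \<tau>)
                   (\<lambda>\<omega>'. indicator {\<omega>'. \<tau> \<omega>' < \<infinity>} \<omega>' * f (X x (enn2real (\<tau> \<omega>') + t) \<omega>')) \<omega> =
                 (\<integral>\<omega>'. f (X (X x (enn2real (\<tau> \<omega>)) \<omega>) t \<omega>') \<partial>M)))))"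


section \<open>Assumptions on the data\<close>

definition locally_lipschitz_on :: "'a::metric_space set \<Rightarrow> ('a \<Rightarrow> 'b::metric_space) \<Rightarrow> bool" where
  "locally_lipschitz_on S f \<longleftrightarrow> (\<forall>x\<in>S. \<exists>\<epsilon>>0. \<exists>C. C-lipschitz_on (cball x \<epsilon> \<inter> S) f)"

definition linear_growth_on ::
  "'a::real_normed_vector set \<Rightarrow> ('a \<Rightarrow> 'b::real_normed_vector) \<Rightarrow> bool" where
  "linear_growth_on S f \<longleftrightarrow> (\<exists>C. \<forall>x\<in>S. norm (f x) \<le> C * (1 + norm x))"

definition locally_elliptic :: "(real^2 \<Rightarrow> real^2^2) \<Rightarrow> bool" where
  "locally_elliptic \<sigma> \<longleftrightarrow>
     (\<forall>K. compact K \<and> K \<subseteq> quadrant \<longrightarrow>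
        (\<exists>l>0. \<forall>x\<in>K. \<forall>\<xi>. l * (norm \<xi>)\<^sup>2 \<le> \<xi> \<bullet> ((\<sigma> x ** transpose (\<sigma> x)) *v \<xi>)))"

definition continuous_flow :: "'w measure \<Rightarrow> (real^2 \<Rightarrow> real \<Rightarrow> 'w \<Rightarrow> real^2) \<Rightarrow> bool" where
  "continuous_flow M X \<longleftrightarrow>
     (\<forall>T>0. \<forall>K. compact K \<and> K \<subseteq> quadrant \<longrightarrow>
        (\<exists>q\<ge>1. \<forall>x\<in>K.
           ((\<lambda>y. \<integral>\<^sup>+\<omega>. (SUP t\<in>{0..T}. ennreal (norm (X y t \<omega> - X x t \<omega>) powr q)) \<partial>M)
              \<longlongrightarrow> 0) (at x within quadrant)))"


section \<open>The optimal stopping problem\<close>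

definition payoff :: "real \<Rightarrow> real^2 \<Rightarrow> real" where
  "payoff \<alpha> x = max (x $ 1) (\<alpha> * x $ 2)"

definition discounted_payoff ::
  "real \<Rightarrow> real \<Rightarrow> (real \<Rightarrow> 'w \<Rightarrow> real^2) \<Rightarrow> ('w \<Rightarrow> ennreal) \<Rightarrow> 'w \<Rightarrow> real" where
  "discounted_payoff r \<alpha> Y \<tau> \<omega> =
     (if \<tau> \<omega> = \<infinity> then 0
      else exp (- r * enn2real (\<tau> \<omega>)) * payoff \<alpha> (Y (enn2real (\<tau> \<omega>)) \<omega>))"

definition running_cost ::
  "real \<Rightarrow> (real^2 \<Rightarrow> real) \<Rightarrow> (real \<Rightarrow> 'w \<Rightarrow> real^2) \<Rightarrow> ('w \<Rightarrow> ennreal) \<Rightarrow> 'w \<Rightarrow> real" where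
  "running_cost r c Y \<tau> \<omega> =
     set_lebesgue_integral lborel {s. 0 \<le> s \<and> ennreal s \<le> \<tau> \<omega>} (\<lambda>s. exp (- r * s) * c (Y s \<omega>))"

text \<open>
  The pathwise condition is needed besides integrability of \<^const>\<open>running_cost\<close>, because the
  integral of a non-integrable function is \<open>0\<close> by convention.
\<close>

definition payoff_terms_integrable ::
  "'w measure \<Rightarrow> real \<Rightarrow> real \<Rightarrow> (real^2 \<Rightarrow> real) \<Rightarrow> (real \<Rightarrow> 'w \<Rightarrow> real^2) \<Rightarrow>
   ('w \<Rightarrow> ennreal) \<Rightarrow> bool" where
  "payoff_terms_integrable M r \<alpha> c Y \<tau> \<longleftrightarrow>
     integrable M (discounted_payoff r \<alpha> Y \<tau>) \<and>
     (AE \<omega> in M. set_integrable lborel {s. 0 \<le> s \<and> ennreal s \<le> \<tau> \<omega>}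
        (\<lambda>s. exp (- r * s) * c (Y s \<omega>))) \<and>
     integrable M (running_cost r c Y \<tau>)"

definition value_function ::
  "'w measure \<Rightarrow> (ennreal \<Rightarrow> 'w measure) \<Rightarrow> real \<Rightarrow> real \<Rightarrow> (real^2 \<Rightarrow> real) \<Rightarrow>
   (real^2 \<Rightarrow> real \<Rightarrow> 'w \<Rightarrow> real^2) \<Rightarrow> real^2 \<Rightarrow> ereal" where
  "value_function M F r \<alpha> c X x =
     (SUP \<tau>\<in>{\<tau>. stopping_time F \<tau>}.
        ereal (\<integral>\<omega>. (discounted_payoff r \<alpha> (X x) \<tau> \<omega> - running_cost r c (X x) \<tau> \<omega>) \<partial>M))"

end

theory Submission
  imports Defs
begin

text \<open>
  Stopping immediately yields \<open>V \<ge> G\<close>, because the reflected diffusion starts almost surely at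
  \<open>x\<close>. Hence \<open>H\<close> is nonnegative, and each vertical section of its zero set is closed by
  continuity and upward closed by monotonicity, that is, the half-line above its infimum.
  Monotonicity of \<open>H\<close> in \<open>x\<^sub>1\<close> makes these half-lines nested.
\<close>

lemma zero_set_eq_atLeast:
  fixes f :: "real \<Rightarrow> real"
  assumes cont: "continuous_on {0..} f" and anti: "antimono_on {0..} f"
    and nonneg: "\<And>y. 0 \<le> y \<Longrightarrow> 0 \<le> f y" and ne: "{y. 0 \<le> y \<and> f y = 0} \<noteq> {}"
  shows "{y. 0 \<le> y \<and> f y = 0} = {Inf {y. 0 \<le> y \<and> f y = 0}..}"
proof -
  let ?Z = "{y. 0 \<le> y \<and> f y = 0}"
  have bdd: "bdd_below ?Z"
    by (rule bdd_belowI[of _ 0]) simp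
  have "closedin (top_of_set {0..}) ({0..} \<inter> f -` {0})"
    using cont by (rule continuous_closedin_preimage) simp
  then have "closed ({0..} \<inter> f -` {0})"
    by (rule closedin_closed_trans) simp
  moreover have "{0..} \<inter> f -` {0} = ?Z"
    by auto
  \<comment> \<open>Closedness makes the infimum a zero itself. Beyond it \<open>f\<close> is
    squeezed between 0 and \<open>f (Inf ?Z)\<close>, which is 0.\<close>
  ultimately have Inf_in: "Inf ?Z \<in> ?Z"
    using closed_contains_Inf[OF ne bdd] by simp
  have "y \<in> ?Z" if y: "Inf ?Z \<le> y" for y
  proof -
    have "0 \<le> y"
      using Inf_in y by auto
    moreover have "f y \<le> f (Inf ?Z)"
      using monotone_onD[OF anti, of "Inf ?Z" y] Inf_in y \<open>0 \<le> y\<close> by auto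
    ultimately show ?thesis
      using nonneg[of y] Inf_in by auto
  qed
  moreover have "Inf ?Z \<le> y" if "y \<in> ?Z" for y
    using that bdd by (rule cInf_lower)
  ultimately show ?thesis
    by blast
qed

lemma usual_conditions_subalgebra:
  assumes "usual_conditions M F"
  shows "subalgebra M (F t)"
  using assms by (auto simp: usual_conditions_def subalgebra_def filtration_def)

text \<open>All partition points up to index \<open>N\<close> are nonnegative, so capping them at
  time 0 turns every increment into \<open>W 0 - W 0\<close>; the value of \<open>W 0\<close> does
  not matter.\<close>

lemma elementary_integral_0:
  assumes "elementary_integrand F N u \<xi>"
  shows "elementary_integral W N u \<xi> 0 \<omega> = 0"
proof -
  have u0: "0 \<le> u 0" and step: "\<And>k. k < N \<Longrightarrow> u k \<le> u (Suc k)"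
    using assms by (auto simp: elementary_integrand_def)
  have "0 \<le> u k" if "k \<le> N" for k
    using that
  proof (induction k)
    case 0
    show ?case by (rule u0)
  next
    case (Suc k)
    then show ?case using step[of k] by simp
  qed
  then show ?thesis
    by (auto simp: elementary_integral_def min_absorb2 intro!: sum.neutral)
qed

text \<open>The integral is known only as a limit in probability, uniform on compacts. Its
  approximants vanish at time 0, so the norm of \<open>I 0\<close> is at most the uniform distance
  to each approximant, and this tends to 0 in probability.\<close>

lemma ito_integral_0:
  fixes I :: "real \<Rightarrow> 'w \<Rightarrow> real^'m"
  assumes uc: "usual_conditions M F" and ito: "is_ito_integral M F W H I"
  shows "AE \<omega> in M. I 0 \<omega> = 0"
proof -
  interpret prob_space M
    using uc by (simp add: usual_conditions_def)
  have "I 0 \<in> borel_measurable (F (ennreal 0))"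
    using ito unfolding is_ito_integral_def adapted_def by blast
  then have [measurable]: "I 0 \<in> borel_measurable M"
    by (rule measurable_from_subalg[OF usual_conditions_subalgebra[OF uc]])
  obtain N u \<xi> where el: "\<And>n. elementary_integrand F (N n) (u n) (\<xi> n)"
    and lim: "\<And>T. T > 0 \<Longrightarrow> tendsto_zero_in_prob M (\<lambda>n \<omega>.
      SUP t\<in>{0..T}. ennreal (norm (elementary_integral W (N n) (u n) (\<xi> n) t \<omega> - I t \<omega>)))"
    using ito unfolding is_ito_integral_def by blast
  \<comment> \<open>The horizon 1 is an arbitrary positive choice; only the time 0 inside it is
    used.\<close>
  define Z where "Z n \<omega> =
    (SUP t\<in>{0..1::real}. ennreal (norm (elementary_integral W (N n) (u n) (\<xi> n) t \<omega> - I t \<omega>)))"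
    for n \<omega>
  have Z: "tendsto_zero_in_prob M Z"
    using lim[of 1] by (simp add: Z_def[abs_def])
  \<comment> \<open>\<open>Z n\<close> is an uncountable supremum; its measurability comes with the
    definition of convergence in probability.\<close>
  then have [measurable]: "Z n \<in> borel_measurable M" for n
    by (simp add: tendsto_zero_in_prob_def)
  have le_Z: "ennreal (norm (I 0 \<omega>)) \<le> Z n \<omega>" for n \<omega>
    unfolding Z_def by (rule SUP_upper2[of 0]) (simp_all add: elementary_integral_0[OF el])
  have bound: "AE \<omega> in M. norm (I 0 \<omega>) \<le> \<epsilon>" if "\<epsilon> > 0" for \<epsilon>
  proof -
    have "prob {\<omega>\<in>space M. \<epsilon> < norm (I 0 \<omega>)} \<le> prob {\<omega>\<in>space M. ennreal \<epsilon> < Z n \<omega>}" for n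
    proof (rule finite_measure_mono)
      show "{\<omega>\<in>space M. \<epsilon> < norm (I 0 \<omega>)} \<subseteq> {\<omega>\<in>space M. ennreal \<epsilon> < Z n \<omega>}"
        using that by (auto intro!: less_le_trans[OF _ le_Z] simp: ennreal_less_iff)
    qed measurable
    moreover have "(\<lambda>n. prob {\<omega>\<in>space M. ennreal \<epsilon> < Z n \<omega>}) \<longlonglongrightarrow> 0"
      using Z that by (simp add: tendsto_zero_in_prob_def)
    ultimately have "prob {\<omega>\<in>space M. \<epsilon> < norm (I 0 \<omega>)} \<le> 0"
      by (intro LIMSEQ_le_const) auto
    then have "prob {\<omega>\<in>space M. \<epsilon> < norm (I 0 \<omega>)} = 0"
      by (simp add: measure_le_0_iff)
    then have "AE \<omega> in M. \<not> \<epsilon> < norm (I 0 \<omega>)"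
      by (subst (asm) prob_eq_0) auto
    then show ?thesis
      by (simp add: not_less)
  qed
  \<comment> \<open>Countably many bounds can share one null set, and
    \<open>1 / real (Suc n)\<close> falls below every positive number.\<close>
  have "AE \<omega> in M. \<forall>n. norm (I 0 \<omega>) \<le> 1 / real (Suc n)"
    unfolding AE_all_countable by (intro allI bound) simp
  then show ?thesis
  proof eventually_elim
    case (elim \<omega>)
    have "norm (I 0 \<omega>) \<le> 0"
      using elim by (meson not_less nat_approx_posE order.strict_trans2 leD leI)
    then show ?case by simp
  qed
qed

text \<open>The starting point is encoded only through the integral equation, valid almost surely.
  At time 0 the drift is integrated over a null set, the Ito integral vanishes by
  \<open>ito_integral_0\<close>, and \<open>L 0\<close> is 0 by the reflection clause.\<close>

lemma reflected_solution_initial: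
  assumes uc: "usual_conditions M F" and sol: "reflected_solution M F W \<mu> \<sigma> x X L"
  shows "AE \<omega> in M. X 0 \<omega> = x"
proof -
  obtain I where ito: "is_ito_integral M F W (\<lambda>s \<omega>. \<sigma> (X s \<omega>)) I"
    and X: "AE \<omega> in M. \<forall>t\<ge>0.
      X t \<omega> = x + set_lebesgue_integral lborel {0..t} (\<lambda>s. \<mu> (X s \<omega>)) + I t \<omega> + L t \<omega>"
    using sol unfolding reflected_solution_def by (elim conjE exE) (rule that)
  have L0: "AE \<omega> in M. \<forall>i. L 0 \<omega> $ i = 0"
    by (rule eventually_mono
        [OF sol[unfolded reflected_solution_def, THEN conjunct2, THEN conjunct2, THEN conjunct2, THEN conjunct1]])
      simp
  show ?thesis
    using X L0 ito_integral_0[OF uc ito]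
  proof eventually_elim
    case (elim \<omega>)
    have "L 0 \<omega> = 0"
      using elim(2) by (simp add: vec_eq_iff)
    moreover have "set_lebesgue_integral lborel {0..0} (\<lambda>s. \<mu> (X s \<omega>)) = 0"
      unfolding set_lebesgue_integral_def
      by (rule integral_eq_zero_AE, rule eventually_mono[OF AE_lborel_singleton[of 0]]) auto
    ultimately show ?case
      using elim(1)[rule_format, of 0] elim(3) by simp
  qed
qed

text \<open>The constant stopping time 0 is admissible in the supremum, and its expected reward is
  \<open>payoff \<alpha> x\<close>.\<close>

lemma payoff_le_value_function:
  assumes uc: "usual_conditions M F" and sol: "reflected_solution M F W \<mu> \<sigma> x (X x) K"
  shows "ereal (payoff \<alpha> x) \<le> value_function M F r \<alpha> c X x"
proof -
  interpret prob_space M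
    using uc by (simp add: usual_conditions_def)
  have "X x 0 \<in> borel_measurable (F (ennreal 0))"
    using sol unfolding reflected_solution_def adapted_def by blast
  then have [measurable]: "X x 0 \<in> borel_measurable M"
    by (rule measurable_from_subalg[OF usual_conditions_subalgebra[OF uc]])
  have [measurable]: "payoff \<alpha> \<in> borel_measurable borel"
    unfolding payoff_def by (intro borel_measurable_continuous_onI continuous_intros)
  \<comment> \<open>For stopping time 0 the domain of integration is the single point 0, a null
    set.\<close>
  have cost: "running_cost r c (X x) (\<lambda>_. 0) \<omega> = 0" for \<omega>
    unfolding running_cost_def set_lebesgue_integral_def
    by (rule integral_eq_zero_AE, rule eventually_mono[OF AE_lborel_singleton[of 0]])
      (auto simp: indicator_def)
  have "(\<integral>\<omega>. (discounted_payoff r \<alpha> (X x) (\<lambda>_. 0) \<omega> - running_cost r c (X x) (\<lambda>_. 0) \<omega>) \<partial>M)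
      = (\<integral>\<omega>. payoff \<alpha> (X x 0 \<omega>) \<partial>M)"
    by (simp add: cost discounted_payoff_def)
  also have "\<dots> = (\<integral>\<omega>. payoff \<alpha> x \<partial>M)"
    using reflected_solution_initial[OF uc sol]
    by (intro integral_cong_AE) (auto elim: eventually_mono)
  also have "\<dots> = payoff \<alpha> x"
    by (simp add: prob_space)
  finally show ?thesis
    unfolding value_function_def
    by (intro SUP_upper2[of "\<lambda>_. 0"]) (simp_all add: stopping_time_const)
qed

theorem theorem3p6:
  fixes M :: "'w measure" and F :: "ennreal \<Rightarrow> 'w measure" and W :: "real \<Rightarrow> 'w \<Rightarrow> real^2"
    and \<mu> :: "real^2 \<Rightarrow> real^2" and \<sigma> :: "real^2 \<Rightarrow> real^2^2" and c :: "real^2 \<Rightarrow> real"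
    and X L :: "real^2 \<Rightarrow> real \<Rightarrow> 'w \<Rightarrow> real^2" and r \<alpha> C\<^sub>V p :: real
    and V H :: "real^2 \<Rightarrow> real" and D :: "(real^2) set"
    and D' :: "real \<Rightarrow> real set" and b :: "real \<Rightarrow> real"
  assumes "r > 0" and "\<alpha> > 0"
    and "usual_conditions M F" and "brownian_motion M F W"
    and A1: "locally_lipschitz_on quadrant \<mu>" "linear_growth_on quadrant \<mu>"
            "locally_lipschitz_on quadrant \<sigma>" "linear_growth_on quadrant \<sigma>"
    and A2: "locally_elliptic \<sigma>"
    and A3: "\<forall>x\<in>quadrant. unique_strong_solution M F W \<mu> \<sigma> x (X x) (L x)"
            "strong_markov M F X"
    and A4: "continuous_flow M X"
    and A5: "continuous_on quadrant c" "\<forall>x\<in>quadrant. 0 \<le> c x"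
    and A6: "C\<^sub>V > 0" "p \<ge> 1"
            "\<forall>x\<in>quadrant. 0 \<le> value_function M F r \<alpha> c X x \<and>
               value_function M F r \<alpha> c X x \<le> ereal (C\<^sub>V * (1 + norm x powr p))"
            "\<forall>x\<in>quadrant. \<forall>\<tau>. stopping_time F \<tau> \<longrightarrow> payoff_terms_integrable M r \<alpha> c (X x) \<tau>"
  defines "V \<equiv> \<lambda>x. real_of_ereal (value_function M F r \<alpha> c X x)"
    and "H \<equiv> \<lambda>x. V x - payoff \<alpha> x"
    and "D \<equiv> {x\<in>quadrant. H x = 0}"
    and "D' \<equiv> \<lambda>x\<^sub>1. {x\<^sub>2. 0 \<le> x\<^sub>2 \<and> vector [x\<^sub>1, x\<^sub>2] \<in> D}"
    and "b \<equiv> \<lambda>x\<^sub>1. Inf (D' x\<^sub>1)"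
  assumes V_cont: "continuous_on quadrant V"
    and H_antimono: "\<forall>x\<^sub>1\<ge>0. antimono_on {0..} (\<lambda>x\<^sub>2. H (vector [x\<^sub>1, x\<^sub>2]))"
    and D_nonempty: "\<forall>x\<^sub>1\<ge>0. D' x\<^sub>1 \<noteq> {}"
  shows "(\<forall>x\<^sub>1\<ge>0. bdd_below (D' x\<^sub>1) \<and> 0 \<le> b x\<^sub>1) \<and>
         D = {x\<in>quadrant. b (x $ 1) \<le> x $ 2} \<and>
         ((\<forall>x\<^sub>2\<ge>0. antimono_on {0..} (\<lambda>x\<^sub>1. H (vector [x\<^sub>1, x\<^sub>2]))) \<longrightarrow> antimono_on {0..} b) \<and>
         ((\<forall>x\<^sub>2\<ge>0. mono_on {0..} (\<lambda>x\<^sub>1. H (vector [x\<^sub>1, x\<^sub>2]))) \<longrightarrow> mono_on {0..} b)"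
proof -
  have H_nonneg: "0 \<le> H x" if x: "x \<in> quadrant" for x
  proof -
    have "reflected_solution M F W \<mu> \<sigma> x (X x) (L x)"
      using A3(1) x by (auto simp: unique_strong_solution_def strong_solution_def)
    then have G_le: "ereal (payoff \<alpha> x) \<le> value_function M F r \<alpha> c X x"
      by (rule payoff_le_value_function[OF \<open>usual_conditions M F\<close>])
    \<comment> \<open>\<open>real_of_ereal\<close> sends infinite values to 0, so finiteness is
      needed to carry the inequality over to \<open>V\<close>.\<close>
    have "\<bar>value_function M F r \<alpha> c X x\<bar> \<noteq> \<infinity>"
      using A6(3) x by (cases "value_function M F r \<alpha> c X x") auto
    then have "payoff \<alpha> x \<le> V x"
      using G_le unfolding V_def by (cases "value_function M F r \<alpha> c X x") auto
    then show ?thesis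
      by (simp add: H_def)
  qed
  have in_quadrant: "vector [s, t] \<in> quadrant" if "0 \<le> s" "0 \<le> t" for s t
    using that by (simp add: quadrant_def)
  have "continuous_on quadrant H"
    unfolding H_def payoff_def by (intro continuous_intros V_cont)
  moreover have "continuous_on {0..} (\<lambda>t. vector [s, t] :: real^2)" for s
  proof -
    \<comment> \<open>In this form the vector is visibly continuous in \<open>t\<close>.\<close>
    have "vector [s, t] = s *\<^sub>R axis 1 1 + t *\<^sub>R (axis 2 1 :: real^2)" for t
      by (simp add: vec_eq_iff forall_2 axis_def)
    then show ?thesis
      by (auto intro!: continuous_intros)
  qed
  ultimately have H_cont: "continuous_on {0..} (\<lambda>t. H (vector [s, t]))" if "0 \<le> s" for s
    using that by (auto intro!: continuous_on_compose2[of quadrant H] in_quadrant)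
  have D'_eq: "D' s = {t. 0 \<le> t \<and> H (vector [s, t]) = 0}" if "0 \<le> s" for s
    using that by (auto simp: D'_def D_def in_quadrant)
  have D'_atLeast: "D' s = {b s..}" if "0 \<le> s" for s
    using that zero_set_eq_atLeast[OF H_cont[OF that]] H_antimono D_nonempty
    unfolding b_def by (auto simp: D'_eq H_nonneg in_quadrant)
  \<comment> \<open>The endpoint \<open>b s\<close> belongs to \<open>D' s\<close>, whose elements
    are all nonnegative.\<close>
  have b_nonneg: "0 \<le> b s" if "0 \<le> s" for s
    using D'_atLeast[OF that] by (auto simp: D'_eq[OF that])
  have D_iff: "x \<in> D \<longleftrightarrow> b (x $ 1) \<le> x $ 2" if x: "x \<in> quadrant" for x
  proof -
    have "x = vector [x $ 1, x $ 2]"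
      by (simp add: vec_eq_iff forall_2)
    then have "x \<in> D \<longleftrightarrow> x $ 2 \<in> D' (x $ 1)"
      using x by (auto simp: D'_def quadrant_def)
    then show ?thesis
      using x D'_atLeast[of "x $ 1"] by (simp add: quadrant_def)
  qed
  \<comment> \<open>One comparison serves both directions of monotonicity: where \<open>H\<close> is
    smaller, the zero section is larger and starts lower. Concretely, \<open>H\<close> at
    \<open>(t, b s)\<close> lies between 0 and its value 0 at \<open>(s, b s)\<close>.\<close>
  have b_le: "b t \<le> b s"
    if "0 \<le> s" "0 \<le> t" and le: "\<And>y. 0 \<le> y \<Longrightarrow> H (vector [t, y]) \<le> H (vector [s, y])" for s t
  proof -
    have "b s \<in> D' s"
      by (simp add: D'_atLeast that)
    then have "b s \<in> D' t"
      using le[of "b s"] H_nonneg[OF in_quadrant, of t "b s"] that by (auto simp: D'_eq)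
    then show ?thesis
      by (simp add: D'_atLeast that)
  qed
  \<comment> \<open>A real \<open>Inf\<close> is meaningful only for nonempty sets bounded below;
    with \<open>D_nonempty\<close> this is the well-definedness of \<open>b\<close>.\<close>
  have "bdd_below (D' s) \<and> 0 \<le> b s" if "0 \<le> s" for s
    using D'_atLeast[OF that] b_nonneg[OF that] by simp
  moreover have "D = {x\<in>quadrant. b (x $ 1) \<le> x $ 2}"
    using D_iff by (auto simp: D_def)
  moreover have "antimono_on {0..} b"
    if "\<forall>y\<ge>0. antimono_on {0..} (\<lambda>s. H (vector [s, y]))"
    using that by (intro monotone_onI b_le) (auto simp: monotone_on_def)
  moreover have "mono_on {0..} b"
    if "\<forall>y\<ge>0. mono_on {0..} (\<lambda>s. H (vector [s, y]))"
    using that by (intro monotone_onI b_le) (auto simp: monotone_on_def)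
  ultimately show ?thesis
    by blast
qed

end
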